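(* Let $\alpha\in(0,1)\setminus\mathbb{Q}$ with partial quotients $a_1,a_2,\dots$. Then $\mathcal{V}_\alpha=\emptyset$ if and only if $$\#\{n\ge1:a_n=1\}=+\infty.$$
   Context: Let $\alpha\in(0,1)\setminus\mathbb{Q}$ have the regular continued fraction expansion $\alpha=\cfrac{1}{a_1+\cfrac{1}{a_2+\cdots}}$ with partial quotients $a_n\in\mathbb{N}$, $n\ge1$. Define $p_1=0$, $p_2=1$, $q_1=1$, $q_2=a_1$, and $p_{n+1}=a_np_n+p_{n-1}$, $q_{n+1}=a_nq_n+q_{n-1}$ for $n\ge2$. Put $\alpha_n=|q_n\alpha-p_n|$ for $n\ge1$. Let $Z_\alpha=\prod_{n=1}^\infty\{0,1,\dots,a_n\}$, and let $\mathcal{V}_\alpha$ be the set of all $x\in(0,1)$ for which there exists exactly one sequence $(x_1,x_2,\dots)\in Z_\alpha$ with $x=\sum_{n=1}^\infty x_n\alpha_n$. *)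

theory Defs
  imports Complex_Main "HOL-Library.FuncSet"
begin

(* All sequences are indexed by n >= 1, as in the mathematics; the value at 0 of a
   sequence of partial quotients is never used. *)

(* cf_trunc a n = 1/(a 1 + 1/(a 2 + ... + 1/(a n))) *)
fun cf_trunc :: "(nat \<Rightarrow> nat) \<Rightarrow> nat \<Rightarrow> real" where
  "cf_trunc a 0 = 0"
| "cf_trunc a (Suc n) = 1 / (real (a 1) + cf_trunc (\<lambda>k. a (Suc k)) n)"

definition has_cf_expansion :: "real \<Rightarrow> (nat \<Rightarrow> nat) \<Rightarrow> bool" where
  "has_cf_expansion \<alpha> a \<longleftrightarrow> (\<forall>n\<ge>1. a n \<ge> 1) \<and> cf_trunc a \<longlonglongrightarrow> \<alpha>"

(* The values p_0 = 1 and q_0 = 0 extend the recursion one step backwards, so that it also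
   produces the prescribed p_2 = 1 and q_2 = a_1. *)
fun cf_p :: "(nat \<Rightarrow> nat) \<Rightarrow> nat \<Rightarrow> nat" where
  "cf_p a 0 = 1"
| "cf_p a (Suc 0) = 0"
| "cf_p a (Suc (Suc n)) = a (Suc n) * cf_p a (Suc n) + cf_p a n"

fun cf_q :: "(nat \<Rightarrow> nat) \<Rightarrow> nat \<Rightarrow> nat" where
  "cf_q a 0 = 0"
| "cf_q a (Suc 0) = 1"
| "cf_q a (Suc (Suc n)) = a (Suc n) * cf_q a (Suc n) + cf_q a n"

lemma cf_p_2: "cf_p a 2 = 1" and cf_q_2: "cf_q a 2 = a 1"
  by (simp_all add: numeral_2_eq_2)

definition cf_alpha :: "real \<Rightarrow> (nat \<Rightarrow> nat) \<Rightarrow> nat \<Rightarrow> real" where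
  "cf_alpha \<alpha> a n = \<bar>real (cf_q a n) * \<alpha> - real (cf_p a n)\<bar>"

(* The extensional product makes a digit sequence determined by its values at n >= 1,
   so that uniqueness below is not spoilt by an irrelevant value at 0. *)
definition Z_set :: "(nat \<Rightarrow> nat) \<Rightarrow> (nat \<Rightarrow> nat) set" where
  "Z_set a = (\<Pi>\<^sub>E n\<in>{1..}. {0..a n})"

definition V_set :: "real \<Rightarrow> (nat \<Rightarrow> nat) \<Rightarrow> real set" where
  "V_set \<alpha> a = {x \<in> {0<..<1}.
     \<exists>!d. d \<in> Z_set a \<and> (\<lambda>n. real (d (Suc n)) * cf_alpha \<alpha> a (Suc n)) sums x}"

(* Every irrational in (0,1) has such an expansion, obtained by iterating the Gauss map. *)

definition gauss_map :: "real \<Rightarrow> real" where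
  "gauss_map x = frac (1 / x)"

definition gauss_digit :: "real \<Rightarrow> nat \<Rightarrow> nat" where
  "gauss_digit x n = nat \<lfloor>1 / (gauss_map ^^ (n - 1)) x\<rfloor>"

lemma gauss_map_irrational:
  assumes "0 < x" "x < 1" "x \<notin> \<rat>"
  shows "0 < gauss_map x" "gauss_map x < 1" "gauss_map x \<notin> \<rat>"
    "gauss_digit x 1 \<ge> 1" "x = 1 / (real (gauss_digit x 1) + gauss_map x)"
proof -
  have inv: "1 / x \<notin> \<rat>"
    using assms Rats_inverse[of "1 / x"] by (auto simp: inverse_eq_divide)
  have eq: "gauss_map x = 1 / x - of_int \<lfloor>1 / x\<rfloor>"
    by (simp add: gauss_map_def frac_def)
  show irr: "gauss_map x \<notin> \<rat>"
  proof
    assume "gauss_map x \<in> \<rat>"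
    then have "gauss_map x + of_int \<lfloor>1 / x\<rfloor> \<in> \<rat>" by simp
    with inv eq show False by simp
  qed
  have "gauss_map x \<ge> 0" "gauss_map x \<noteq> 0"
    using irr by (simp add: gauss_map_def, metis Rats_0)
  then show "0 < gauss_map x" by simp
  show "gauss_map x < 1" by (simp add: gauss_map_def frac_lt_1)
  have "1 \<le> 1 / x" using assms by simp
  then have fl: "\<lfloor>1 / x\<rfloor> \<ge> 1" by linarith
  then have "nat \<lfloor>1 / x\<rfloor> \<ge> 1" by linarith
  then show "gauss_digit x 1 \<ge> 1" by (simp add: gauss_digit_def)
  have "real (gauss_digit x 1) = of_int \<lfloor>1 / x\<rfloor>" using fl assms(1) by (simp add: gauss_digit_def)
  then have "real (gauss_digit x 1) + gauss_map x = 1 / x" using eq by simp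
  then show "x = 1 / (real (gauss_digit x 1) + gauss_map x)" by simp
qed

lemma gauss_digit_Suc: "n \<ge> 1 \<Longrightarrow> gauss_digit x (Suc n) = gauss_digit (gauss_map x) n"
  by (cases n) (simp_all add: gauss_digit_def funpow_swap1)

lemma gauss_digit_pos:
  assumes "0 < x" "x < 1" "x \<notin> \<rat>" "n \<ge> 1"
  shows "gauss_digit x n \<ge> 1"
  using assms(4,1-3)
proof (induction n arbitrary: x rule: dec_induct)
  case base then show ?case using gauss_map_irrational by blast
next
  case (step n)
  then show ?case using gauss_map_irrational[of x] gauss_digit_Suc[of n x] by simp
qed

lemma cf_trunc_cong: "(\<And>n. n \<ge> 1 \<Longrightarrow> a n = b n) \<Longrightarrow> cf_trunc a n = cf_trunc b n"
proof (induction n arbitrary: a b)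
  case (Suc n)
  then have "cf_trunc (\<lambda>k. a (Suc k)) n = cf_trunc (\<lambda>k. b (Suc k)) n" by (metis le_Suc_eq)
  with Suc.prems show ?case by simp
qed simp

lemma cf_trunc_nonneg: "cf_trunc a n \<ge> 0"
  by (induction n arbitrary: a) auto

lemma cf_trunc_gauss:
  "cf_trunc (gauss_digit x) (Suc n) =
     1 / (real (gauss_digit x 1) + cf_trunc (gauss_digit (gauss_map x)) n)"
  using cf_trunc_cong[of "\<lambda>k. gauss_digit x (Suc k)" "gauss_digit (gauss_map x)" n]
  by (simp add: gauss_digit_Suc)

lemma cf_trunc_gauss_error:
  assumes "0 < x" "x < 1" "x \<notin> \<rat>"
  shows "\<bar>cf_trunc (gauss_digit x) n - x\<bar> \<le> (1/2) ^ (n div 2)"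
  using assms
proof (induction n arbitrary: x rule: less_induct)
  case (less n)
  consider "n = 0" | "n = 1" | m where "n = Suc (Suc m)"
    by (metis One_nat_def not0_implies_Suc)
  then show ?case
  proof cases
    case 1 then show ?thesis using less.prems by simp
  next
    case 2
    have "gauss_digit x 1 \<ge> 1" using gauss_map_irrational less.prems by blast
    then have "0 \<le> 1 / real (gauss_digit x 1)" "1 / real (gauss_digit x 1) \<le> 1" by auto
    then have "\<bar>1 / real (gauss_digit x 1) - x\<bar> \<le> 1" using less.prems by linarith
    then show ?thesis using 2 by simp
  next
    case 3
    define y where "y = gauss_map x"
    define z where "z = gauss_map y"
    define c d where "c = real (gauss_digit x 1)" and "d = real (gauss_digit y 1)"
    define v where "v = cf_trunc (gauss_digit z) m"
    note gx = gauss_map_irrational[OF less.prems, folded y_def]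
    note gy = gauss_map_irrational[OF gx(1-3), folded z_def]
    have cd: "c \<ge> 1" "d \<ge> 1" using gx(4) gy(4) by (simp_all add: c_def d_def)
    have v0: "v \<ge> 0" by (simp add: v_def cf_trunc_nonneg)
    have IH: "\<bar>v - z\<bar> \<le> (1/2) ^ (m div 2)"
      unfolding v_def using less.IH[of m z] gy 3 by simp
    define V W where "V = c * (d + v) + 1" and "W = c * (d + z) + 1"
    have V: "V \<ge> 2"
      using mult_mono[of 1 c 1 "d + v"] cd v0 by (simp add: V_def)
    have W: "W \<ge> 2"
      using mult_mono[of 1 c 1 "d + z"] cd gy(1) by (simp add: W_def)
    have "cf_trunc (gauss_digit x) n = 1 / (c + 1 / (d + v))"
      unfolding 3 cf_trunc_gauss by (simp add: c_def d_def v_def y_def z_def)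
    also have "\<dots> = (d + v) / V"
      using cd v0 by (simp add: V_def field_simps)
    finally have e1: "cf_trunc (gauss_digit x) n = (d + v) / V" .
    have "x = 1 / (c + 1 / (d + z))" using gx(5) gy(5) by (simp add: c_def d_def)
    also have "\<dots> = (d + z) / W"
      using cd gy(1) by (simp add: W_def field_simps)
    finally have e2: "x = (d + z) / W" .
    have "(d + v) / V - (d + z) / W = ((d + v) * W - (d + z) * V) / (V * W)"
      using V W by (simp add: field_simps)
    also have "(d + v) * W - (d + z) * V = v - z"
      by (simp add: V_def W_def algebra_simps)
    finally have "\<bar>cf_trunc (gauss_digit x) n - x\<bar> = \<bar>v - z\<bar> / (V * W)"
      using e1 e2 V W by simp
    also have "\<dots> \<le> \<bar>v - z\<bar> / 2"
      using mult_mono[of 1 V 2 W] V W by (intro divide_left_mono) auto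
    also have "\<dots> \<le> (1/2) ^ (n div 2)" using IH 3 by simp
    finally show ?thesis .
  qed
qed

lemma has_cf_expansion_exists:
  assumes "0 < \<alpha>" "\<alpha> < 1" "\<alpha> \<notin> \<rat>"
  shows "\<exists>a. has_cf_expansion \<alpha> a"
proof -
  have "filterlim (\<lambda>n::nat. n div 2) at_top sequentially"
    unfolding filterlim_at_top eventually_sequentially
    by (metis div_le_mono nonzero_mult_div_cancel_left zero_neq_numeral)
  then have "(\<lambda>n. (1/2::real) ^ (n div 2)) \<longlonglongrightarrow> 0"
    by (rule filterlim_compose[rotated]) (simp add: LIMSEQ_realpow_zero)
  then have "(\<lambda>n. cf_trunc (gauss_digit \<alpha>) n - \<alpha>) \<longlonglongrightarrow> 0"
    by (rule metric_tendsto_imp_tendsto) (use cf_trunc_gauss_error[OF assms] in \<open>simp add: dist_norm\<close>)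
  then have "cf_trunc (gauss_digit \<alpha>) \<longlonglongrightarrow> \<alpha>"
    by (simp add: LIM_zero_iff)
  then show ?thesis
    using gauss_digit_pos[OF assms] unfolding has_cf_expansion_def by blast
qed

end

theory Submission
  imports Defs
begin

text \<open>
  Write \<open>w n = \<alpha>\<^sub>n\<close>, with \<open>w 0 = 1\<close>. These numbers are the products of the first \<open>n\<close> Gauss
  iterates of \<open>\<alpha>\<close>, so they are positive and satisfy \<open>w (n - 1) = a\<^sub>n w n + w (n + 1)\<close>. Hence they
  decrease to 0, and telescoping shows that the expansions by the digits from position \<open>n\<close> on
  represent precisely the numbers of the interval \<open>[0, w (n - 1) + w n]\<close>.

  Uniqueness of an expansion thereby becomes a condition on its tails \<open>r\<^sub>n\<close> (the part from
  position \<open>n\<close> on). A digit \<open>d\<^sub>n\<close> can be raised by 1 exactly if \<open>d\<^sub>n < a\<^sub>n\<close> and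
  \<open>r\<^bsub>n+1\<^esub> \<ge> w n\<close>, since what is left of the tail can then be expanded again; it can be lowered
  exactly if \<open>d\<^sub>n > 0\<close> and \<open>r\<^bsub>n+1\<^esub> \<le> w (n + 1)\<close>. An expansion is unique if and only if neither
  move is possible at any position; call it rigid then.

  If \<open>a\<^sub>n = 1\<close>, the digit at \<open>n\<close> is extreme, and rigidity forces the tail \<open>r\<^sub>n\<close> to be either
  very small, \<open>r\<^sub>n < w n\<close>, or very large, \<open>r\<^sub>n > w (n - 1)\<close>. Rigidity hands either alternative
  down to all earlier positions. A large tail makes the whole value exceed \<open>w 0 = 1\<close>; a small one
  makes all earlier digits 0. For infinitely many such \<open>n\<close>, a value below 1 must therefore be 0.
  If instead \<open>a\<^sub>n \<ge> 2\<close> for all \<open>n > N\<close>, the expansion with digits 0 up to \<open>N\<close> and 1 afterwards is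
  rigid: twice a tail of ones is at most \<open>\<Sum>k\<ge>n. a\<^sub>k w k = w (n - 1) + w n\<close>, so
  \<open>w n < r\<^sub>n < w (n - 1)\<close>.
\<close>

section \<open>Expansions in a base with a three-term recursion\<close>

text \<open>
  Positions are counted from 0 here: the digit at position \<open>n\<close> is bounded by \<open>A n\<close> and has weight
  \<open>w (Suc n)\<close>, so that \<open>w n\<close> is the weight preceding it.
\<close>

locale recursive_base =
  fixes A :: "nat \<Rightarrow> nat" and w :: "nat \<Rightarrow> real"
  assumes A_pos: "A n \<ge> 1"
    and w_pos: "w n > 0"
    and w_rec: "w n = real (A n) * w (Suc n) + w (Suc (Suc n))"
begin

definition admissible :: "(nat \<Rightarrow> nat) \<Rightarrow> bool" where
  "admissible c \<longleftrightarrow> (\<forall>k. c k \<le> A k)"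

definition tail :: "(nat \<Rightarrow> nat) \<Rightarrow> nat \<Rightarrow> real" where
  "tail c n = (\<Sum>k. real (c (n + k)) * w (Suc (n + k)))"

lemma w_Suc_add_le: "w (Suc n) + w (Suc (Suc n)) \<le> w n"
  using mult_right_mono[of 1 "real (A n)" "w (Suc n)"] A_pos[of n] w_pos[of "Suc n"] w_rec[of n]
  by simp

lemma w_Suc_less: "w (Suc n) < w n"
  using w_Suc_add_le[of n] w_pos[of "Suc (Suc n)"] by linarith

lemma w_antimono: "m \<le> n \<Longrightarrow> w n \<le> w m"
  using w_Suc_less by (metis decseqD decseq_SucI less_imp_le)

text \<open>The limit \<open>L\<close> of the decreasing weights inherits \<open>L + L \<le> L\<close> from the recursion.\<close>

lemma w_tendsto_0: "w \<longlonglongrightarrow> 0"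
proof -
  obtain L where L: "w \<longlonglongrightarrow> L" "\<forall>i. L \<le> w i"
    using decseq_convergent[of w 0] w_pos w_Suc_less by (metis decseq_SucI less_imp_le)
  have "L \<ge> 0"
    using LIMSEQ_le_const[OF L(1), of 0] w_pos by (meson less_imp_le)
  moreover have "L + L \<le> L"
  proof (rule LIMSEQ_le)
    show "(\<lambda>n. w (Suc n) + w (Suc (Suc n))) \<longlonglongrightarrow> L + L"
      using LIMSEQ_Suc[OF L(1)] LIMSEQ_Suc[OF LIMSEQ_Suc[OF L(1)]] by (rule tendsto_add)
    show "w \<longlonglongrightarrow> L" by fact
  qed (use w_Suc_add_le in blast)
  ultimately show ?thesis using L(1) by simp
qed

lemma maximal_digits_sums:
  "(\<lambda>k. real (A (n + k)) * w (Suc (n + k))) sums (w n + w (Suc n))"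
proof -
  have "(\<Sum>k<m. real (A (n + k)) * w (Suc (n + k)))
      = w n + w (Suc n) - (w (n + m) + w (Suc (n + m)))" for m
  proof (induction m)
    case (Suc m)
    then show ?case using w_rec[of "n + m"] by simp
  qed simp
  moreover have "(\<lambda>m. w n + w (Suc n) - (w (n + m) + w (Suc (n + m)))) \<longlonglongrightarrow> w n + w (Suc n) - (0 + 0)"
    using LIMSEQ_ignore_initial_segment[OF w_tendsto_0, of n]
      LIMSEQ_ignore_initial_segment[OF w_tendsto_0, of "Suc n"]
    by (intro tendsto_intros) (simp_all add: add.commute)
  ultimately show ?thesis by (simp add: sums_def)
qed

lemma tail_summable:
  assumes "admissible c"
  shows "summable (\<lambda>k. real (c (n + k)) * w (Suc (n + k)))"
proof (rule summable_comparison_test')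
  show "summable (\<lambda>k. real (A (n + k)) * w (Suc (n + k)))"
    using maximal_digits_sums sums_summable by blast
  show "norm (real (c (n + k)) * w (Suc (n + k))) \<le> real (A (n + k)) * w (Suc (n + k))"
    if "k \<ge> 0" for k
    using assms w_pos[of "Suc (n + k)"] by (auto simp: admissible_def abs_mult intro!: mult_right_mono)
qed

lemma tail_0_sums:
  assumes "admissible c"
  shows "(\<lambda>k. real (c k) * w (Suc k)) sums tail c 0"
  using summable_sums[OF tail_summable[OF assms, of 0]] by (simp add: tail_def)

lemma tail_step:
  assumes "admissible c"
  shows "tail c n = real (c n) * w (Suc n) + tail c (Suc n)"
  using suminf_split_head[OF tail_summable[OF assms, of n]] by (simp add: tail_def)

lemma tail_nonneg: "admissible c \<Longrightarrow> tail c n \<ge> 0"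
  unfolding tail_def using w_pos by (intro suminf_nonneg tail_summable) (auto simp: less_imp_le)

lemma tail_le:
  assumes "admissible c"
  shows "tail c n \<le> w n + w (Suc n)"
proof -
  have "tail c n \<le> (\<Sum>k. real (A (n + k)) * w (Suc (n + k)))"
    unfolding tail_def
    using assms w_pos sums_summable[OF maximal_digits_sums]
    by (intro suminf_le tail_summable) (auto simp: admissible_def intro!: mult_right_mono less_imp_le)
  then show ?thesis using sums_unique[OF maximal_digits_sums] by simp
qed

lemma tail_eq_of_prefix:
  assumes "admissible c" "admissible e" "\<And>k. k < n \<Longrightarrow> e k = c k"
  shows "tail e 0 = tail c 0 \<longleftrightarrow> tail e n = tail c n"
  using assms(3)
proof (induction n)
  case (Suc n)
  then show ?case using tail_step[OF assms(1), of n] tail_step[OF assms(2), of n] by simp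
qed simp

text \<open>
  One greedy step: after the largest possible digit either less than one weight remains, or the
  digit is maximal and the recursion bounds the remainder.
\<close>

lemma greedy_digit:
  assumes "0 \<le> r" "r \<le> w n + w (Suc n)"
  obtains d where "d \<le> A n" "0 \<le> r - real d * w (Suc n)"
    "r - real d * w (Suc n) \<le> w (Suc n) + w (Suc (Suc n))"
proof (cases "real (A n) * w (Suc n) \<le> r")
  case True
  then show ?thesis using that[of "A n"] assms w_rec[of n] by simp
next
  case False
  define d where "d = nat \<lfloor>r / w (Suc n)\<rfloor>"
  have "r / w (Suc n) \<ge> 0" using assms(1) w_pos[of "Suc n"] by simp
  then have d: "real d \<le> r / w (Suc n)" "r / w (Suc n) < real d + 1"
    unfolding d_def by linarith+
  then have d': "real d * w (Suc n) \<le> r" "r < (real d + 1) * w (Suc n)"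
    using w_pos[of "Suc n"] by (simp_all add: field_simps)
  have "real d * w (Suc n) < real (A n) * w (Suc n)" using d'(1) False by linarith
  then have "d \<le> A n" using w_pos[of "Suc n"] by simp
  then show ?thesis using that[of d] d' w_pos[of "Suc (Suc n)"] by (simp add: algebra_simps)
qed

text \<open>
  The values of tails fill their whole interval. Any prefix can be prescribed, so that this also
  serves to continue an expansion after a changed digit.
\<close>

lemma exists_continuation:
  assumes "admissible c" "0 \<le> r" "r \<le> w n + w (Suc n)"
  obtains e where "admissible e" "\<And>k. k < n \<Longrightarrow> e k = c k" "tail e n = r"
proof -
  have "\<exists>f. \<forall>k. (0 \<le> f k \<and> f k \<le> w (n + k) + w (Suc (n + k)) \<and> (k = 0 \<longrightarrow> f k = r))
      \<and> (\<exists>d\<le>A (n + k). f (Suc k) = f k - real d * w (Suc (n + k)))"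
  proof (rule dependent_nat_choice)
    show "\<exists>x. 0 \<le> x \<and> x \<le> w (n + 0) + w (Suc (n + 0)) \<and> (0 = (0::nat) \<longrightarrow> x = r)"
      using assms by auto
  next
    fix x k
    assume "0 \<le> x \<and> x \<le> w (n + k) + w (Suc (n + k)) \<and> (k = 0 \<longrightarrow> x = r)"
    then obtain d where "d \<le> A (n + k)" "0 \<le> x - real d * w (Suc (n + k))"
      "x - real d * w (Suc (n + k)) \<le> w (Suc (n + k)) + w (Suc (Suc (n + k)))"
      using greedy_digit[of x "n + k"] by auto
    then have "0 \<le> x - real d * w (Suc (n + k)) \<and>
        x - real d * w (Suc (n + k)) \<le> w (n + Suc k) + w (Suc (n + Suc k)) \<and>
        (\<exists>d'\<le>A (n + k). x - real d * w (Suc (n + k)) = x - real d' * w (Suc (n + k)))"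
      by auto
    then show "\<exists>y. (0 \<le> y \<and> y \<le> w (n + Suc k) + w (Suc (n + Suc k)) \<and> (Suc k = 0 \<longrightarrow> y = r))
        \<and> (\<exists>d\<le>A (n + k). y = x - real d * w (Suc (n + k)))"
      by blast
  qed
  then obtain f where f: "\<And>k. 0 \<le> f k" "\<And>k. f k \<le> w (n + k) + w (Suc (n + k))" "f 0 = r"
    and ex: "\<And>k. \<exists>d\<le>A (n + k). f (Suc k) = f k - real d * w (Suc (n + k))"
    by blast
  from ex obtain d where d: "\<And>k. d k \<le> A (n + k)"
    "\<And>k. f (Suc k) = f k - real (d k) * w (Suc (n + k))"
    by metis
  define e where "e k = (if k < n then c k else d (k - n))" for k
  have adm: "admissible e"
    unfolding admissible_def
  proof
    fix k
    show "e k \<le> A k"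
      using assms(1) d(1)[of "k - n"] by (cases "k < n") (simp_all add: admissible_def e_def)
  qed
  have "f \<longlonglongrightarrow> 0"
  proof (rule tendsto_sandwich[OF _ _ tendsto_const[of 0]])
    show "(\<lambda>k. w (n + k) + w (Suc (n + k))) \<longlonglongrightarrow> 0"
      using tendsto_add[OF LIMSEQ_ignore_initial_segment[OF w_tendsto_0, of n]
        LIMSEQ_ignore_initial_segment[OF w_tendsto_0, of "Suc n"]]
      by (simp add: add.commute)
  qed (use f in auto)
  then have "(\<lambda>k. f k - f (Suc k)) sums (f 0 - 0)" by (rule telescope_sums')
  then have "(\<lambda>k. real (e (n + k)) * w (Suc (n + k))) sums r"
    using d(2) f(3) by (simp add: e_def)
  then have "tail e n = r" by (simp add: tail_def sums_iff)
  then show ?thesis using that[of e] adm by (simp add: e_def)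
qed

section \<open>Unique expansions are the rigid ones\<close>

text \<open>
  The two conjuncts say that the digit at \<open>n\<close> can be neither raised nor lowered by 1 at the
  expense of the tail behind it.
\<close>

definition rigid :: "(nat \<Rightarrow> nat) \<Rightarrow> bool" where
  "rigid c \<longleftrightarrow> (\<forall>n. (c n = A n \<or> tail c (Suc n) < w (Suc n))
                  \<and> (c n = 0 \<or> w (Suc (Suc n)) < tail c (Suc n)))"

text \<open>
  Because every number of the tail interval is the value of a continuation, a single digit can be
  changed as soon as the remainder it leaves falls into that interval.
\<close>

lemma exists_other_expansion:
  assumes "admissible c" "d \<le> A n" "d \<noteq> c n"
    and "0 \<le> tail c n - real d * w (Suc n)"
    and "tail c n - real d * w (Suc n) \<le> w (Suc n) + w (Suc (Suc n))"
  obtains e where "admissible e" "tail e 0 = tail c 0" "e \<noteq> c"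
proof -
  have adm: "admissible (c(n := d))" using assms(1,2) by (simp add: admissible_def)
  obtain e where e: "admissible e" "\<And>k. k < Suc n \<Longrightarrow> e k = (c(n := d)) k"
    "tail e (Suc n) = tail c n - real d * w (Suc n)"
    using exists_continuation[OF adm, of "tail c n - real d * w (Suc n)" "Suc n"] assms(4,5)
    by blast
  have "e n = d" using e(2)[of n] by simp
  then have "tail e n = tail c n" using tail_step[OF e(1), of n] e(3) by simp
  then have "tail e 0 = tail c 0"
    using tail_eq_of_prefix[OF assms(1) e(1), of n] e(2) by simp
  then show ?thesis using that e(1) \<open>e n = d\<close> assms(3) by metis
qed

lemma unique_imp_rigid:
  assumes c: "admissible c"
    and unique: "\<And>e. admissible e \<Longrightarrow> tail e 0 = tail c 0 \<Longrightarrow> e = c"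
  shows "rigid c"
  unfolding rigid_def
proof (intro allI conjI; rule ccontr)
  fix n
  assume raise: "\<not> (c n = A n \<or> tail c (Suc n) < w (Suc n))"
  have "c n \<le> A n" using c by (simp add: admissible_def)
  then have "Suc (c n) \<le> A n" using raise by simp
  then show False
    using exists_other_expansion[OF c, of "Suc (c n)" n] unique raise
      tail_step[OF c, of n] tail_le[OF c, of "Suc n"] w_pos[of "Suc n"]
    by (auto simp: algebra_simps)
next
  fix n
  assume lower: "\<not> (c n = 0 \<or> w (Suc (Suc n)) < tail c (Suc n))"
  then have "real (c n - 1) = real (c n) - 1" "c n - 1 \<le> A n" "c n - 1 \<noteq> c n"
    using c by (auto simp: admissible_def of_nat_diff le_diff_conv le_SucI)
  then show False
    using exists_other_expansion[OF c, of "c n - 1" n] unique lower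
      tail_step[OF c, of n] tail_nonneg[OF c, of "Suc n"] w_pos[of "Suc n"]
    by (auto simp: algebra_simps)
qed

text \<open>
  At the first position where a second expansion differs, its digit is larger or smaller by at
  least 1; the interval of possible tails then exhibits the move that rigidity excludes.
\<close>

lemma rigid_imp_unique:
  assumes c: "admissible c" and "rigid c" and e: "admissible e" and eq: "tail e 0 = tail c 0"
  shows "e = c"
proof (rule ccontr)
  assume "e \<noteq> c"
  then obtain m where "e m \<noteq> c m" by auto
  define n where "n = (LEAST n. e n \<noteq> c n)"
  have n: "e n \<noteq> c n" "\<And>k. k < n \<Longrightarrow> e k = c k"
    using \<open>e m \<noteq> c m\<close> LeastI[of "\<lambda>n. e n \<noteq> c n"] not_less_Least[of _ "\<lambda>n. e n \<noteq> c n"]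
    unfolding n_def by blast+
  have tails: "real (e n) * w (Suc n) + tail e (Suc n) = real (c n) * w (Suc n) + tail c (Suc n)"
    using tail_eq_of_prefix[OF c e n(2)] eq tail_step[OF c, of n] tail_step[OF e, of n] by simp
  from n(1) consider "c n < e n" | "e n < c n" by linarith
  then show False
  proof cases
    case 1
    then have "(real (c n) + 1) * w (Suc n) \<le> real (e n) * w (Suc n)"
      using w_pos[of "Suc n"] by (intro mult_right_mono) auto
    then have "w (Suc n) \<le> tail c (Suc n)"
      using tails tail_nonneg[OF e, of "Suc n"] by (simp add: algebra_simps)
    moreover have "c n \<noteq> A n" using 1 e by (auto simp: admissible_def not_le[symmetric])
    ultimately show False using \<open>rigid c\<close> by (auto simp: rigid_def not_le[symmetric])
  next
    case 2
    then have "(real (e n) + 1) * w (Suc n) \<le> real (c n) * w (Suc n)"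
      using w_pos[of "Suc n"] by (intro mult_right_mono) auto
    then have "tail c (Suc n) \<le> w (Suc (Suc n))"
      using tails tail_le[OF e, of "Suc n"] by (simp add: algebra_simps)
    then show False using \<open>rigid c\<close> 2 unfolding rigid_def by (metis not_le not_less_zero)
  qed
qed

lemma unique_expansion_iff:
  "(\<exists>!c. admissible c \<and> (\<lambda>k. real (c k) * w (Suc k)) sums x)
     \<longleftrightarrow> (\<exists>c. admissible c \<and> rigid c \<and> tail c 0 = x)"
proof -
  have sums: "(\<lambda>k. real (c k) * w (Suc k)) sums x \<longleftrightarrow> tail c 0 = x" if "admissible c" for c
    using tail_0_sums[OF that] sums_unique2 by blast
  show ?thesis
  proof
    assume "\<exists>!c. admissible c \<and> (\<lambda>k. real (c k) * w (Suc k)) sums x"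
    then show "\<exists>c. admissible c \<and> rigid c \<and> tail c 0 = x"
      using sums unique_imp_rigid by metis
  next
    assume "\<exists>c. admissible c \<and> rigid c \<and> tail c 0 = x"
    then show "\<exists>!c. admissible c \<and> (\<lambda>k. real (c k) * w (Suc k)) sums x"
      using sums rigid_imp_unique by metis
  qed
qed

section \<open>Rigid expansions and the digit bound 1\<close>

text \<open>
  A tail below the next weight forces the preceding digit to be 0, which keeps the tail from
  there on equally small.
\<close>

lemma rigid_small_tail:
  assumes "admissible c" "rigid c" "tail c n < w (Suc n)" "k < n"
  shows "c k = 0"
  using assms(3,4)
proof (induction n)
  case (Suc n)
  have "c n = 0" using assms(2) Suc.prems(1) unfolding rigid_def by (metis less_asym)
  moreover have "tail c n < w (Suc n)"
    using \<open>c n = 0\<close> tail_step[OF assms(1), of n] Suc.prems(1) w_Suc_less[of "Suc n"] by simp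
  ultimately show ?case using Suc by (metis less_antisym)
qed simp

text \<open>
  Symmetrically, a tail above the preceding weight forces the preceding digit to be maximal, which
  keeps the tail from there on equally large.
\<close>

lemma rigid_large_tail:
  assumes "admissible c" "rigid c" "w n < tail c n"
  shows "w 0 < tail c 0"
  using assms(3)
proof (induction n)
  case (Suc n)
  have "c n = A n" using assms(2) Suc.prems unfolding rigid_def by (metis less_asym)
  then have "tail c n > w n"
    using tail_step[OF assms(1), of n] Suc.prems w_rec[of n] w_Suc_less[of "Suc n"] by simp
  then show ?case using Suc.IH by simp
qed simp

text \<open>
  With bound 1 the digit is 0 or maximal. The digit 0 passes the bound on the next tail on
  unchanged; the digit 1 adds \<open>w (Suc n)\<close> to it, and \<open>w (Suc n) + w (Suc (Suc n)) = w n\<close>.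
\<close>

lemma rigid_digit_bound_one:
  assumes "admissible c" "rigid c" "A n = 1"
  shows "tail c n < w (Suc n) \<or> w n < tail c n"
proof (cases "c n = 0")
  case True
  then show ?thesis
    using assms(2,3) tail_step[OF assms(1), of n] unfolding rigid_def
    by (metis One_nat_def add_0 mult_zero_left of_nat_0 zero_neq_one)
next
  case False
  then have "c n = 1" using assms(1,3) by (metis admissible_def less_one le_less)
  moreover have "w (Suc (Suc n)) < tail c (Suc n)" 
    using False assms(2)[unfolded rigid_def, THEN spec, of n] by simp
  ultimately show ?thesis using tail_step[OF assms(1), of n] w_rec[of n] assms(3) by simp
qed

lemma rigid_trivial:
  assumes "admissible c" "rigid c" "infinite {n. A n = 1}" "tail c 0 \<le> w 0"
  shows "tail c 0 = 0"
proof -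
  have "c k = 0" for k
  proof -
    obtain n where "k < n" "A n = 1"
      using assms(3) unfolding finite_nat_set_iff_bounded_le by (auto simp: not_le)
    then show ?thesis
      using rigid_digit_bound_one[OF assms(1,2)] rigid_large_tail[OF assms(1,2), of n]
        rigid_small_tail[OF assms(1,2)] assms(4) by force
  qed
  then show ?thesis by (simp add: tail_def)
qed

text \<open>
  Eventually constant digits 1 lie strictly between the extreme digits 0 and \<open>A n \<ge> 2\<close>, and their
  tails strictly between consecutive weights because they are at most half of the maximal tails.
\<close>

lemma exists_rigid:
  assumes two: "\<And>n. n \<ge> N \<Longrightarrow> A n \<ge> 2"
  obtains c where "admissible c" "rigid c" "0 < tail c 0" "tail c 0 < w 0"
proof -
  define c :: "nat \<Rightarrow> nat" where "c n = (if n < N then 0 else 1)" for n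
  have adm: "admissible c" using A_pos by (simp add: admissible_def c_def)
  have upper: "tail c n < w n" if "N \<le> n" for n
  proof -
    have adm2: "admissible (\<lambda>k. 2 * c k)"
      using two A_pos by (auto simp: admissible_def c_def)
    have "tail (\<lambda>k. 2 * c k) n = 2 * tail c n"
      using suminf_mult[OF tail_summable[OF adm, of n], of 2] by (simp add: tail_def mult.assoc)
    then show ?thesis using tail_le[OF adm2, of n] w_Suc_less[of n] by linarith
  qed
  have lower: "w (Suc n) < tail c n" if "N \<le> n" for n
    using tail_step[OF adm, of n] tail_step[OF adm, of "Suc n"] tail_nonneg[OF adm, of "Suc (Suc n)"]
      w_pos[of "Suc (Suc n)"] that by (simp add: c_def)
  have initial: "tail c n = tail c N" if "n \<le> N" for n
    using that
  proof (induction rule: inc_induct)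
    case (step n)
    have "tail c n = tail c (Suc n)"
      using tail_step[OF adm, of n] step.hyps by (simp add: c_def)
    then show ?case using step.IH by (rule trans)
  qed simp
  have "rigid c"
    unfolding rigid_def
  proof (intro allI conjI)
    fix n
    show "c n = A n \<or> tail c (Suc n) < w (Suc n)"
    proof (cases "n < N")
      case True
      then have "tail c (Suc n) = tail c N" "w N \<le> w (Suc n)"
        using initial[of "Suc n"] w_antimono[of "Suc n" N] by simp_all
      then show ?thesis using upper[of N] by linarith
    qed (use upper[of "Suc n"] in simp)
    show "c n = 0 \<or> w (Suc (Suc n)) < tail c (Suc n)"
      using lower[of "Suc n"] by (simp add: c_def)
  qed
  moreover have "0 < tail c 0" "tail c 0 < w 0"
    using initial[of 0] lower[of N] upper[of N] w_pos[of "Suc N"] w_antimono[of 0 N] by auto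
  ultimately show ?thesis using that adm by blast
qed

end

section \<open>The weights of a continued fraction\<close>

text \<open>
  Dropping the first partial quotient is the Gauss map: the truncations of the shifted expansion
  converge to \<open>1 / \<alpha> - a\<^sub>1\<close>, which is nonnegative as such a limit and nonzero by irrationality.
\<close>

lemma has_cf_expansion_shift:
  assumes "0 < \<alpha>" "\<alpha> \<notin> \<rat>" "has_cf_expansion \<alpha> a"
  shows "has_cf_expansion (1 / \<alpha> - real (a 1)) (\<lambda>k. a (Suc k))"
    "0 < 1 / \<alpha> - real (a 1)" "1 / \<alpha> - real (a 1) \<notin> \<rat>"
proof -
  define \<beta> where "\<beta> = 1 / \<alpha> - real (a 1)"
  have "(\<lambda>n. cf_trunc a (Suc n)) \<longlonglongrightarrow> \<alpha>"
    using assms(3) unfolding has_cf_expansion_def by (intro LIMSEQ_Suc) blast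
  then have "(\<lambda>n. 1 / cf_trunc a (Suc n) - real (a 1)) \<longlonglongrightarrow> \<beta>"
    unfolding \<beta>_def using assms(1) by (intro tendsto_intros) auto
  then have lim: "cf_trunc (\<lambda>k. a (Suc k)) \<longlonglongrightarrow> \<beta>" by simp
  then show "has_cf_expansion (1 / \<alpha> - real (a 1)) (\<lambda>k. a (Suc k))"
    using assms(3) by (simp add: has_cf_expansion_def \<beta>_def)
  have irr: "\<beta> \<notin> \<rat>"
  proof
    assume "\<beta> \<in> \<rat>"
    then have "inverse (\<beta> + real (a 1)) \<in> \<rat>" by (intro Rats_inverse Rats_add) auto
    then show False using assms(2) by (simp add: \<beta>_def inverse_eq_divide)
  qed
  moreover have "\<beta> \<ge> 0" using LIMSEQ_le_const[OF lim] cf_trunc_nonneg by blast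
  ultimately show "0 < 1 / \<alpha> - real (a 1)" "1 / \<alpha> - real (a 1) \<notin> \<rat>"
    unfolding \<beta>_def[symmetric] by (auto simp: le_less)
qed

text \<open>
  The sign is the one that turns the recursion of \<open>cf_p\<close> and \<open>cf_q\<close> into \<open>w_rec\<close>; that the
  values are positive, and thus equal to \<open>cf_alpha\<close>, comes out afterwards.
\<close>

definition signed_error :: "real \<Rightarrow> (nat \<Rightarrow> nat) \<Rightarrow> nat \<Rightarrow> real" where
  "signed_error \<alpha> a n = (- 1) ^ Suc n * (real (cf_q a n) * \<alpha> - real (cf_p a n))"

lemma signed_error_rec:
  "signed_error \<alpha> a n = real (a (Suc n)) * signed_error \<alpha> a (Suc n) + signed_error \<alpha> a (Suc (Suc n))"
  by (simp add: signed_error_def algebra_simps)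

lemma abs_signed_error: "\<bar>signed_error \<alpha> a n\<bar> = cf_alpha \<alpha> a n"
  by (simp add: signed_error_def cf_alpha_def abs_mult power_abs)

text \<open>
  The signed errors are the products \<open>t 0 \<cdots> t (n - 1)\<close> of the Gauss iterates
  \<open>t n\<close> of \<open>\<alpha>\<close>: both sequences obey the same recursion, because
  \<open>1 - a\<^bsub>n+1\<^esub> t n = t n * t (n + 1)\<close>.
\<close>

lemma signed_error_pos:
  assumes "0 < \<alpha>" "\<alpha> \<notin> \<rat>" "has_cf_expansion \<alpha> a"
  shows "signed_error \<alpha> a n > 0"
proof -
  define t where "t = rec_nat \<alpha> (\<lambda>n x. 1 / x - real (a (Suc n)))"
  have t_simps: "t 0 = \<alpha>" "\<And>n. t (Suc n) = 1 / t n - real (a (Suc n))" by (simp_all add: t_def)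
  have t: "0 < t n \<and> t n \<notin> \<rat> \<and> has_cf_expansion (t n) (\<lambda>k. a (n + k))" for n
  proof (induction n)
    case (Suc n)
    then show ?case using has_cf_expansion_shift[of "t n" "\<lambda>k. a (n + k)"] by (simp add: t_simps)
  qed (use assms t_simps in simp)
  have "signed_error \<alpha> a n > 0 \<and> signed_error \<alpha> a (Suc n) = t n * signed_error \<alpha> a n" for n
  proof (induction n)
    case 0
    show ?case by (simp add: signed_error_def t_simps)
  next
    case (Suc n)
    have "signed_error \<alpha> a (Suc (Suc n)) = signed_error \<alpha> a n * (1 - real (a (Suc n)) * t n)"
      using signed_error_rec[of \<alpha> a n] Suc by (simp add: algebra_simps)
    also have "1 - real (a (Suc n)) * t n = t (Suc n) * t n"
      using t[of n] by (simp add: t_simps field_simps)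
    finally show ?case using Suc t[of n] by (simp add: algebra_simps)
  qed
  then show ?thesis by blast
qed

lemma recursive_base_cf_alpha:
  assumes "0 < \<alpha>" "\<alpha> \<notin> \<rat>" "has_cf_expansion \<alpha> a"
  shows "recursive_base (\<lambda>n. a (Suc n)) (cf_alpha \<alpha> a)"
proof -
  have "cf_alpha \<alpha> a = signed_error \<alpha> a"
  proof
    fix n
    show "cf_alpha \<alpha> a n = signed_error \<alpha> a n"
      using abs_of_pos[OF signed_error_pos[OF assms, of n]] abs_signed_error[of \<alpha> a n] by linarith
  qed
  moreover have "recursive_base (\<lambda>n. a (Suc n)) (signed_error \<alpha> a)"
  proof
    show "1 \<le> a (Suc n)" for n using assms(3) by (simp add: has_cf_expansion_def)
  qed (fact signed_error_pos[OF assms] signed_error_rec)+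
  ultimately show ?thesis by simp
qed

lemma ex1_reindex:
  assumes "bij_betw g D C" "\<And>d. d \<in> D \<Longrightarrow> P d \<longleftrightarrow> Q (g d)"
  shows "(\<exists>!d. d \<in> D \<and> P d) \<longleftrightarrow> (\<exists>!c. c \<in> C \<and> Q c)"
proof -
  have "bij_betw g {d \<in> D. P d} {c \<in> C. Q c}"
    using assms by (auto simp: bij_betw_def inj_on_def)
  then have "is_singleton {d \<in> D. P d} \<longleftrightarrow> is_singleton {c \<in> C. Q c}"
    by (metis bij_betw_same_card is_singleton_altdef)
  then show ?thesis by (simp add: is_singleton_iff_ex1)
qed

lemma bij_betw_Z_set:
  "bij_betw (\<lambda>d n. d (Suc n)) (Z_set a) {c. \<forall>n. c n \<le> a (Suc n)}"
proof (rule bij_betwI[where g = "\<lambda>c. \<lambda>n\<in>{1..}. c (n - 1)"])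
  show "(\<lambda>c. \<lambda>n\<in>{1..}. c (n - 1)) \<in> {c. \<forall>n. c n \<le> a (Suc n)} \<rightarrow> Z_set a"
  proof
    fix c assume c: "c \<in> {c. \<forall>n. c n \<le> a (Suc n)}"
    have "c (n - 1) \<le> a n" if "n \<ge> 1" for n
      using c that by (cases n) auto
    then show "(\<lambda>n\<in>{1..}. c (n - 1)) \<in> Z_set a" by (auto simp: Z_set_def)
  qed
  show "(\<lambda>n\<in>{1..}. d (Suc (n - 1))) = d" if "d \<in> Z_set a" for d
    using that by (auto simp: Z_set_def PiE_def extensional_def fun_eq_iff)
qed (auto simp: Z_set_def PiE_def Pi_def)

theorem proposition3p12:
  fixes \<alpha> :: real and a :: "nat \<Rightarrow> nat"
  assumes "0 < \<alpha>" and "\<alpha> < 1" and "\<alpha> \<notin> \<rat>"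
    and "has_cf_expansion \<alpha> a"
  shows "V_set \<alpha> a = {} \<longleftrightarrow> infinite {n. n \<ge> 1 \<and> a n = 1}"
proof -
  interpret recursive_base "\<lambda>n. a (Suc n)" "cf_alpha \<alpha> a"
    using recursive_base_cf_alpha assms by blast
  have w0: "cf_alpha \<alpha> a 0 = 1" by (simp add: cf_alpha_def)
  have "(\<exists>!d. d \<in> Z_set a \<and> (\<lambda>n. real (d (Suc n)) * cf_alpha \<alpha> a (Suc n)) sums x)
      \<longleftrightarrow> (\<exists>c. admissible c \<and> rigid c \<and> tail c 0 = x)" for x
    unfolding unique_expansion_iff[symmetric]
    using ex1_reindex[OF bij_betw_Z_set, of a
        "\<lambda>d. (\<lambda>n. real (d (Suc n)) * cf_alpha \<alpha> a (Suc n)) sums x"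
        "\<lambda>c. (\<lambda>n. real (c n) * cf_alpha \<alpha> a (Suc n)) sums x"]
    by (simp add: admissible_def)
  then have V: "V_set \<alpha> a = {tail c 0 |c. admissible c \<and> rigid c \<and> 0 < tail c 0 \<and> tail c 0 < 1}"
    by (auto simp: V_set_def)
  have "{n. n \<ge> 1 \<and> a n = 1} = Suc ` {n. a (Suc n) = 1}"
    by (auto simp: image_iff) (metis Suc_pred' Suc_le_eq One_nat_def)
  then have ones: "infinite {n. n \<ge> 1 \<and> a n = 1} \<longleftrightarrow> infinite {n. a (Suc n) = 1}"
    by (simp add: finite_image_iff)
  show ?thesis
    unfolding ones
  proof
    assume empty: "V_set \<alpha> a = {}"
    show "infinite {n. a (Suc n) = 1}"
    proof
      assume "finite {n. a (Suc n) = 1}"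
      then obtain N where "\<forall>n\<in>{n. a (Suc n) = 1}. n < N"
        unfolding finite_nat_set_iff_bounded by blast
      then have "a (Suc n) \<ge> 2" if "n \<ge> N" for n
        using A_pos[of n] that by (cases "a (Suc n) = 1") force+
      then show False using exists_rigid[of N] empty unfolding V w0 by blast
    qed
  next
    assume "infinite {n. a (Suc n) = 1}"
    then show "V_set \<alpha> a = {}" unfolding V using rigid_trivial w0 by fastforce
  qed
qed

end
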